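(* Let $\Lambda$ be a lattice of signature $(1,n-1)$, $h\in\Lambda$ with $(h^2)>0$, $\mathcal C^+:=\{x\in\Lambda_{\mathbb R}:(x^2)>0,\ (x,h)>0\}$, and $N>0$. Let $\Pi=\sum_{i=1}^m\mathbb R_{\ge0}x_i$ be a cone contained in $\overline{\mathcal C^+}$ with $x_1,\dots,x_m\in\Lambda_{\mathbb Q}$. Then the set $\{v\in\Lambda : (v^2)>-N,\ v^\perp\cap\Pi\cap\mathcal C^+\neq\emptyset\}$ is finite.
   Context: $(x^2)$ abbreviates $(x,x)$; $\overline{\mathcal C^+}$ is the closure of $\mathcal C^+$ in $\Lambda_{\mathbb R}$; $v^\perp$ is the orthogonal hyperplane of $v$ in $\Lambda_{\mathbb R}$. *)

theory Defs
  imports "HOL-Analysis.Analysis"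
begin

text \<open>A lattice of rank n is modelled as \<Lambda> = \<int>^n inside \<Lambda>_\<real> = \<real>^n (index type 'n),
  with the bilinear form given by a symmetric integral Gram matrix B.\<close>

definition bform :: "real^'n^'n \<Rightarrow> real^'n \<Rightarrow> real^'n \<Rightarrow> real" where
  "bform B x y = x \<bullet> (B *v y)"

definition lattice_pts :: "(real^'n) set" where
  "lattice_pts = {v. \<forall>i. v $ i \<in> \<int>}"

definition rational_pts :: "(real^'n) set" where
  "rational_pts = {v. \<forall>i. v $ i \<in> \<rat>}"

definition integral_symmetric_form :: "real^'n^'n \<Rightarrow> bool" where
  "integral_symmetric_form B \<longleftrightarrow> transpose B = B \<and> (\<forall>i j. B $ i $ j \<in> \<int>)"

text \<open>Signature (1, n-1): over \<real> the form is congruent to diag(1,-1,...,-1).\<close>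
definition signature_1_nm1 :: "real^'n^'n \<Rightarrow> bool" where
  "signature_1_nm1 B \<longleftrightarrow> (\<exists>(P::real^'n^'n) i0. invertible P \<and>
     transpose P ** B ** P = (\<chi> i j. if i = j then (if i = i0 then 1 else -1) else 0))"

definition pos_cone :: "real^'n^'n \<Rightarrow> real^'n \<Rightarrow> (real^'n) set" where
  "pos_cone B h = {x. bform B x x > 0 \<and> bform B x h > 0}"

definition gen_cone :: "(real^'n) set \<Rightarrow> (real^'n) set" where
  "gen_cone X = {y. \<exists>c. (\<forall>x\<in>X. c x \<ge> 0) \<and> y = (\<Sum>x\<in>X. c x *\<^sub>R x)}"

end

theory Submission
  imports Defs
begin

text \<open>
  Proof idea.  Write q(v) = (v,v).  Diagonalising the form over \<real> turns it into the
  Lorentz form 2 a0 b0 - a\<bullet>b, for which a reverse Cauchy--Schwarz inequality holds: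
  the orthogonal complement of a timelike vector z (q(z) > 0) is negative definite.
  Consequently a "slab" {v lattice. q(v) > -L, |(v,z)| \<le> K} is bounded, hence finite.

  Now let v be a lattice vector orthogonal to some x0 = \<Sum> c_u u in the cone over X
  with q(x0) > 0.  Either v separates two generators x, y with positive weight
  ((v,x) > 0 > (v,y)), or v is orthogonal to every generator of positive weight and then,
  since q(x0) > 0, to two generators x, y with (x,y) > 0.  In both cases v lies in a
  finite slab for z = x + y: in the second case trivially, in the first case by an
  estimate in the hyperbolic plane spanned by x and y combined with the discreteness of
  the values (v,x), (v,y) for rational x, y.  Finitely many pairs (x, y) give the theorem.
\<close>

section \<open>Bilinear algebra of \<open>bform\<close>\<close>

text \<open>bform B is bilinear for every Gram matrix B.\<close>
lemma bform_add_left: "bform B (x + y) z = bform B x z + bform B y z"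
  and bform_add_right: "bform B z (x + y) = bform B z x + bform B z y"
  and bform_diff_left: "bform B (x - y) z = bform B x z - bform B y z"
  and bform_diff_right: "bform B z (x - y) = bform B z x - bform B z y"
  and bform_scaleR_left: "bform B (r *\<^sub>R x) z = r * bform B x z"
  and bform_scaleR_right: "bform B z (r *\<^sub>R x) = r * bform B z x"
  and bform_zero_left: "bform B 0 z = 0"
  and bform_zero_right: "bform B z 0 = 0"
  unfolding bform_def
  by (simp_all add: inner_add_left inner_add_right inner_diff_left inner_diff_right
      matrix_vector_right_distrib matrix_vector_mult_diff_distrib matrix_vector_mult_scaleR)

lemmas bform_linear = bform_add_left bform_add_right bform_diff_left bform_diff_right
  bform_scaleR_left bform_scaleR_right bform_zero_left bform_zero_right

text \<open>Linearity over finite combinations, as used for points of gen_cone.\<close>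
lemma bform_sum_left:
  "finite X \<Longrightarrow> bform B (\<Sum>u\<in>X. c u *\<^sub>R u) z = (\<Sum>u\<in>X. c u * bform B u z)"
  by (induction X rule: finite_induct) (simp_all add: bform_linear)

lemma bform_sum_right:
  "finite X \<Longrightarrow> bform B z (\<Sum>u\<in>X. c u *\<^sub>R u) = (\<Sum>u\<in>X. c u * bform B z u)"
  by (induction X rule: finite_induct) (simp_all add: bform_linear)

text \<open>A change of basis P replaces the Gram matrix B by its congruent P^T B P.\<close>
lemma bform_congruence:
  "bform B (P *v a) (P *v b) = bform (transpose P ** B ** P) a b"
proof -
  have "bform B (P *v a) (P *v b) = (a v* transpose P) \<bullet> (B *v (P *v b))"
    unfolding bform_def by (simp add: transpose_matrix_vector[symmetric])
  also have "\<dots> = a \<bullet> (transpose P *v (B *v (P *v b)))"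
    by (rule dot_lmul_matrix)
  also have "transpose P *v (B *v (P *v b)) = (transpose P ** B ** P) *v b"
    by (simp add: matrix_vector_mul_assoc matrix_mul_assoc)
  finally show ?thesis unfolding bform_def .
qed

section \<open>The Lorentz model\<close>

text \<open>The Lorentz matrix diag(1,-1,...,-1), with the entry 1 at index i0.\<close>
definition lorentz_matrix :: "'n \<Rightarrow> real^'n^'n" where
  "lorentz_matrix i0 = (\<chi> i j. if i = j then (if i = i0 then 1 else -1) else 0)"

lemma lorentz_matrix_mult: "lorentz_matrix i0 *v b = (\<chi> i. if i = i0 then b$i else - b$i)"
proof -
  have row: "(\<Sum>j\<in>UNIV. (if i = j then c else 0) * b$j) = c * b$i" for i and c :: real
  proof -
    have "(\<Sum>j\<in>UNIV. (if i = j then c else 0) * b$j) = (\<Sum>j\<in>UNIV. if i = j then c * b$j else 0)"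
      by (rule sum.cong) auto
    thus ?thesis by simp
  qed
  show ?thesis
    unfolding lorentz_matrix_def by (simp add: vec_eq_iff matrix_vector_mult_def row)
qed

lemma bform_lorentz: "bform (lorentz_matrix i0) a b = 2 * (a$i0) * (b$i0) - a \<bullet> b"
proof -
  have "bform (lorentz_matrix i0) a b = (\<Sum>i\<in>UNIV. a$i * (if i = i0 then b$i else - b$i))"
    unfolding bform_def lorentz_matrix_mult inner_vec_def by simp
  also have "\<dots> = (\<Sum>i\<in>UNIV. (if i = i0 then 2 * (a$i * b$i) else 0) - a$i * b$i)"
    by (rule sum.cong) auto
  also have "\<dots> = 2 * (a$i0) * (b$i0) - a \<bullet> b"
    by (simp add: sum_subtractf inner_vec_def)
  finally show ?thesis .
qed

lemma lorentz_sym: "bform (lorentz_matrix i0) a b = bform (lorentz_matrix i0) b a"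
  by (simp add: bform_lorentz inner_commute mult.commute)

text \<open>Timelike vectors are nonzero.\<close>
lemma lorentz_timelike_nonzero:
  assumes "bform (lorentz_matrix i0) y y > 0"
  shows "y \<bullet> y > 0"
  using assms by (cases "y = 0") (simp_all add: bform_zero_left)

text \<open>Reverse Cauchy--Schwarz: on the orthogonal complement of a timelike y the Lorentz
  form is negative definite, with an explicit constant.\<close>
lemma lorentz_reverse_cauchy_schwarz:
  fixes y w :: "real^'n"
  assumes y: "bform (lorentz_matrix i0) y y > 0" and wy: "bform (lorentz_matrix i0) w y = 0"
  shows "bform (lorentz_matrix i0) w w * (y \<bullet> y) \<le> - bform (lorentz_matrix i0) y y * (w \<bullet> w)"
proof -
  define e :: "real^'n" where "e = axis i0 1"
  have xe: "x \<bullet> e = x$i0" for x :: "real^'n" unfolding e_def by (simp add: inner_axis)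
  have e: "x \<bullet> e = x$i0" "e \<bullet> x = x$i0" "e \<bullet> e = 1" "e$i0 = 1" for x :: "real^'n"
    using xe[of x] xe[of e] by (simp_all add: inner_commute e_def)
  text \<open>Cauchy--Schwarz for the spatial parts w - w0 e and y - y0 e.\<close>
  have "((w - (w$i0) *\<^sub>R e) \<bullet> (y - (y$i0) *\<^sub>R e))^2
        \<le> ((w - (w$i0) *\<^sub>R e) \<bullet> (w - (w$i0) *\<^sub>R e)) * ((y - (y$i0) *\<^sub>R e) \<bullet> (y - (y$i0) *\<^sub>R e))"
    by (rule Cauchy_Schwarz_ineq)
  hence cs: "(w \<bullet> y - w$i0 * y$i0)^2 \<le> (w \<bullet> w - (w$i0)^2) * (y \<bullet> y - (y$i0)^2)"
    by (simp add: inner_diff_left inner_diff_right e algebra_simps power2_eq_square)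
  have wy': "w \<bullet> y = 2 * w$i0 * y$i0" using wy by (simp add: bform_lorentz)
  have "(w$i0)^2 * (y \<bullet> y) \<le> (w \<bullet> w) * (y \<bullet> y - (y$i0)^2)"
    using cs unfolding wy' by (simp add: algebra_simps power2_eq_square)
  thus ?thesis by (simp add: bform_lorentz algebra_simps power2_eq_square)
qed

text \<open>Slab bound: vectors u with q(u) > -L and |(u,y)| \<le> K for a fixed timelike y
  have bounded norm.  Decompose u = w + t y with w orthogonal to y and apply the reverse
  Cauchy--Schwarz inequality to w.\<close>
lemma lorentz_slab_bounded:
  fixes y :: "real^'n"
  assumes y: "bform (lorentz_matrix i0) y y > 0"
  shows "\<exists>R. \<forall>u. bform (lorentz_matrix i0) u u > - L \<and> \<bar>bform (lorentz_matrix i0) u y\<bar> \<le> K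
           \<longrightarrow> norm u \<le> R"
proof -
  define q where "q = bform (lorentz_matrix i0)"
  have qy: "q y y > 0" using y unfolding q_def .
  have yy: "y \<bullet> y > 0" using y lorentz_timelike_nonzero by blast
  define M where "M = (L + K^2 / q y y) * (y \<bullet> y) / q y y"
  define R where "R = sqrt (max 0 M) + K / q y y * norm y"
  have "norm u \<le> R" if u: "q u u > - L" "\<bar>q u y\<bar> \<le> K" for u
  proof -
    define t where "t = q u y / q y y"
    define w where "w = u - t *\<^sub>R y"
    have wy: "q w y = 0"
      unfolding w_def q_def bform_diff_left bform_scaleR_left using qy
      by (simp add: t_def q_def)
    have uw: "u = w + t *\<^sub>R y" unfolding w_def by simp
    have yw: "q y w = 0" using wy lorentz_sym unfolding q_def by metis
    have "q u u = q w w + t * q w y + t * q y w + t * t * q y y"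
      unfolding uw q_def by (simp add: bform_linear algebra_simps)
    also have "\<dots> = q w w + t * t * q y y" using wy yw by simp
    also have "t * t * q y y = (q u y)^2 / q y y"
      unfolding t_def using qy by (simp add: power2_eq_square)
    also have "\<dots> \<le> K^2 / q y y"
      using qy u(2) abs_le_square_iff[of "q u y" K] by (simp add: divide_right_mono)
    finally have qw: "q w w > - L - K^2 / q y y" using u(1) by linarith
    have "q w w * (y \<bullet> y) \<le> - q y y * (w \<bullet> w)"
      using lorentz_reverse_cauchy_schwarz[of i0 y w] y wy unfolding q_def by blast
    moreover have "(- L - K^2 / q y y) * (y \<bullet> y) < q w w * (y \<bullet> y)"
      using qw yy by (rule mult_strict_right_mono)
    ultimately have "q y y * (w \<bullet> w) < (L + K^2 / q y y) * (y \<bullet> y)" by argo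
    hence "w \<bullet> w < M" unfolding M_def using qy by (simp add: field_simps)
    hence nw: "norm w \<le> sqrt (max 0 M)" by (simp add: norm_eq_sqrt_inner)
    have "\<bar>t\<bar> \<le> K / q y y" unfolding t_def using u(2) qy by (simp add: abs_divide divide_right_mono)
    hence "\<bar>t\<bar> * norm y \<le> K / q y y * norm y" by (rule mult_right_mono) simp
    moreover have "norm u \<le> norm w + \<bar>t\<bar> * norm y"
      unfolding uw using norm_triangle_ineq[of w "t *\<^sub>R y"] by simp
    ultimately show ?thesis unfolding R_def using nw by linarith
  qed
  thus ?thesis unfolding q_def by blast
qed

section \<open>Forms of signature (1, n-1)\<close>

text \<open>Coordinates in which a form of signature (1, n-1) becomes the Lorentz form.\<close>
lemma lorentzian_coordinates:
  fixes B :: "real^'n^'n"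
  assumes "signature_1_nm1 B"
  obtains P Q :: "real^'n^'n" and i0
  where "P ** Q = mat 1" and "\<And>x y. bform B x y = bform (lorentz_matrix i0) (Q *v x) (Q *v y)"
proof -
  obtain P :: "real^'n^'n" and i0 where "invertible P" and PD: "transpose P ** B ** P = lorentz_matrix i0"
    using assms unfolding signature_1_nm1_def lorentz_matrix_def by blast
  then obtain Q where PQ: "P ** Q = mat 1" unfolding invertible_def by blast
  have "bform B x y = bform (lorentz_matrix i0) (Q *v x) (Q *v y)" for x y
  proof -
    have "bform B x y = bform B (P *v (Q *v x)) (P *v (Q *v y))"
      by (simp add: matrix_vector_mul_assoc PQ)
    thus ?thesis unfolding bform_congruence PD .
  qed
  with PQ show thesis by (rule that)
qed

text \<open>A form of signature (1, n-1) is symmetric, being congruent to the Lorentz form.\<close>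
lemma lorentzian_sym:
  fixes B :: "real^'n^'n"
  assumes "signature_1_nm1 B"
  shows "bform B x y = bform B y x"
proof -
  obtain P Q :: "real^'n^'n" and i0 :: 'n where "P ** Q = mat 1"
    and tr: "\<And>x y. bform B x y = bform (lorentz_matrix i0) (Q *v x) (Q *v y)"
    using lorentzian_coordinates[OF assms] by blast
  show ?thesis unfolding tr by (rule lorentz_sym)
qed

text \<open>Expansion of the quadratic form on linear combinations.\<close>
lemma lorentzian_quadratic_comb:
  fixes B :: "real^'n^'n"
  assumes "signature_1_nm1 B"
  shows "bform B (a *\<^sub>R x + c *\<^sub>R y) (a *\<^sub>R x + c *\<^sub>R y)
           = a^2 * bform B x x + 2*a*c*bform B x y + c^2 * bform B y y"
  using lorentzian_sym[OF assms, of y x]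
  by (simp add: bform_linear power2_eq_square algebra_simps)

lemma lorentzian_quadratic_add:
  fixes B :: "real^'n^'n"
  assumes "signature_1_nm1 B"
  shows "bform B (x + y) (x + y) = bform B x x + 2 * bform B x y + bform B y y"
  using lorentzian_quadratic_comb[OF assms, of 1 x 1 y] by simp

text \<open>The orthogonal complement of a timelike vector is negative definite.\<close>
lemma lorentzian_orthogonal_timelike:
  fixes B :: "real^'n^'n"
  assumes B: "signature_1_nm1 B" and z: "bform B z z > 0" and wz: "bform B w z = 0"
  shows "bform B w w \<le> 0" and "bform B w w = 0 \<Longrightarrow> w = 0"
proof -
  obtain P Q :: "real^'n^'n" and i0 :: 'n where PQ: "P ** Q = mat 1"
    and tr: "\<And>x y. bform B x y = bform (lorentz_matrix i0) (Q *v x) (Q *v y)"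
    using lorentzian_coordinates[OF B] by blast
  let ?q = "bform (lorentz_matrix i0)" and ?y = "Q *v z" and ?w = "Q *v w"
  have y: "?q ?y ?y > 0" using z tr by simp
  have yy: "?y \<bullet> ?y > 0" using lorentz_timelike_nonzero[OF y] .
  have rcs: "bform B w w * (?y \<bullet> ?y) \<le> - ?q ?y ?y * (?w \<bullet> ?w)"
    using lorentz_reverse_cauchy_schwarz[OF y] wz tr by simp
  also have "\<dots> \<le> 0" using y by (simp add: mult_nonneg_nonneg)
  finally show "bform B w w \<le> 0" using yy by (simp add: mult_le_0_iff)
  assume "bform B w w = 0"
  hence "?q ?y ?y * (?w \<bullet> ?w) \<le> 0" using rcs by simp
  hence "?w \<bullet> ?w \<le> 0" using y by (simp add: mult_le_0_iff)
  hence "?w = 0" using inner_ge_zero[of ?w] by simp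
  hence "P *v ?w = 0" by simp
  thus "w = 0" by (simp add: matrix_vector_mul_assoc PQ)
qed

text \<open>A bounded set contains only finitely many lattice points.\<close>
lemma finite_lattice_bounded:
  assumes "bounded S"
  shows "finite (S \<inter> lattice_pts)"
proof -
  obtain r where r: "\<forall>x\<in>S. norm x \<le> r" using assms bounded_iff by blast
  define A :: "real set" where "A = of_int ` {-\<lceil>r\<rceil>..\<lceil>r\<rceil>}"
  have "S \<inter> lattice_pts \<subseteq> vec_lambda ` (PiE UNIV (\<lambda>_. A))"
  proof
    fix x assume x: "x \<in> S \<inter> lattice_pts"
    have "x $ i \<in> A" for i
    proof -
      obtain k where k: "x $ i = of_int k"
        using x unfolding lattice_pts_def by (auto elim: Ints_cases)
      have "\<bar>real_of_int k\<bar> \<le> r" using r x component_le_norm_cart[of x i] k by auto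
      hence "k \<in> {-\<lceil>r\<rceil>..\<lceil>r\<rceil>}" by (auto simp: abs_le_iff) linarith+
      thus ?thesis unfolding A_def using k by auto
    qed
    hence "(\<lambda>i. x $ i) \<in> PiE UNIV (\<lambda>_. A)" by auto
    moreover have "x = vec_lambda (\<lambda>i. x $ i)" by simp
    ultimately show "x \<in> vec_lambda ` (PiE UNIV (\<lambda>_. A))" by blast
  qed
  moreover have "finite (vec_lambda ` (PiE UNIV (\<lambda>_::'n::finite. A)))"
    unfolding A_def by (intro finite_imageI finite_PiE) auto
  ultimately show ?thesis by (rule finite_subset)
qed

text \<open>The key finiteness statement: a slab around the orthogonal complement of a timelike
  vector contains only finitely many lattice vectors of bounded-below norm.\<close>
lemma lorentzian_finite_slab:
  fixes B :: "real^'n^'n"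
  assumes B: "signature_1_nm1 B" and z: "bform B z z > 0"
  shows "finite {v \<in> lattice_pts. bform B v v > - L \<and> \<bar>bform B v z\<bar> \<le> K}"
proof -
  obtain P Q :: "real^'n^'n" and i0 :: 'n where PQ: "P ** Q = mat 1"
    and tr: "\<And>x y. bform B x y = bform (lorentz_matrix i0) (Q *v x) (Q *v y)"
    using lorentzian_coordinates[OF B] by blast
  obtain R where R: "\<And>u. bform (lorentz_matrix i0) u u > - L
      \<and> \<bar>bform (lorentz_matrix i0) u (Q *v z)\<bar> \<le> K \<Longrightarrow> norm u \<le> R"
    using lorentz_slab_bounded[of i0 "Q *v z" L K] z tr by auto
  have "{v \<in> lattice_pts. bform B v v > - L \<and> \<bar>bform B v z\<bar> \<le> K}
        \<subseteq> ((*v) P ` cball 0 R) \<inter> lattice_pts"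
  proof
    fix v assume v: "v \<in> {v \<in> lattice_pts. bform B v v > - L \<and> \<bar>bform B v z\<bar> \<le> K}"
    hence "norm (Q *v v) \<le> R" using R tr by auto
    moreover have "v = P *v (Q *v v)" by (simp add: matrix_vector_mul_assoc PQ)
    ultimately show "v \<in> ((*v) P ` cball 0 R) \<inter> lattice_pts" using v by auto
  qed
  moreover have "finite (((*v) P ` cball 0 R) \<inter> lattice_pts)"
    by (intro finite_lattice_bounded bounded_linear_image) auto
  ultimately show ?thesis by (rule finite_subset)
qed

section \<open>The closed positive cone\<close>

text \<open>The causal cone {q(x) \<ge> 0, (x,h) \<ge> 0} contains the closure of the positive cone.\<close>
definition causal_cone :: "real^'n^'n \<Rightarrow> real^'n \<Rightarrow> (real^'n) set" where
  "causal_cone B h = {x. bform B x x \<ge> 0 \<and> bform B x h \<ge> 0}"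

lemma closure_pos_cone_subset: "closure (pos_cone B h) \<subseteq> causal_cone B h"
proof (rule closure_minimal)
  show "pos_cone B h \<subseteq> causal_cone B h"
    unfolding pos_cone_def causal_cone_def by auto
  have "continuous_on UNIV (\<lambda>x. bform B x x)" "continuous_on UNIV (\<lambda>x. bform B x h)"
    unfolding bform_def by (intro continuous_intros matrix_vector_mult_linear_continuous_on)+
  thus "closed (causal_cone B h)"
    unfolding causal_cone_def by (intro closed_Collect_conj closed_Collect_le continuous_on_const)
qed

text \<open>A causal vector orthogonal to the timelike h vanishes.\<close>
lemma causal_cone_orthogonal_zero:
  fixes B :: "real^'n^'n"
  assumes B: "signature_1_nm1 B" and hh: "bform B h h > 0"
    and x: "x \<in> causal_cone B h" and xh: "bform B x h = 0"
  shows "x = 0"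
  using lorentzian_orthogonal_timelike[OF B hh xh] x unfolding causal_cone_def by simp

text \<open>Two vectors of the causal cone pair nonnegatively: t x - s y with s = (x,h), t = (y,h)
  is orthogonal to h, hence has q \<le> 0.\<close>
lemma causal_cone_pairing_nonneg:
  fixes B :: "real^'n^'n"
  assumes B: "signature_1_nm1 B" and hh: "bform B h h > 0"
    and x: "x \<in> causal_cone B h" and y: "y \<in> causal_cone B h"
  shows "bform B x y \<ge> 0"
proof -
  define s where "s = bform B x h"
  define t where "t = bform B y h"
  consider "s = 0" | "t = 0" | "s > 0" "t > 0"
    using x y unfolding s_def t_def causal_cone_def by fastforce
  thus ?thesis
  proof cases
    case 1
    thus ?thesis using causal_cone_orthogonal_zero[OF B hh x] s_def by (simp add: bform_zero_left)
  next
    case 2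
    thus ?thesis using causal_cone_orthogonal_zero[OF B hh y] t_def by (simp add: bform_zero_right)
  next
    case 3
    have "bform B (t *\<^sub>R x + (- s) *\<^sub>R y) h = 0"
      unfolding s_def t_def by (simp add: bform_linear)
    hence "bform B (t *\<^sub>R x + (- s) *\<^sub>R y) (t *\<^sub>R x + (- s) *\<^sub>R y) \<le> 0"
      using lorentzian_orthogonal_timelike(1)[OF B hh] by blast
    hence "t^2 * bform B x x - 2 * t * s * bform B x y + s^2 * bform B y y \<le> 0"
      unfolding lorentzian_quadratic_comb[OF B] by simp
    moreover have "t^2 * bform B x x + s^2 * bform B y y \<ge> 0"
      using x y unfolding causal_cone_def by simp
    ultimately have "0 \<le> (t * s) * bform B x y" by (simp add: algebra_simps)
    moreover have "t * s > 0" using 3 by simp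
    ultimately show ?thesis by (simp add: zero_le_mult_iff)
  qed
qed

text \<open>If a vector v separates x and y ((v,x) > 0 > (v,y)), then x and y span a hyperbolic
  plane: their Gram determinant is negative.\<close>
lemma separated_gram_det_neg:
  fixes B :: "real^'n^'n"
  assumes B: "signature_1_nm1 B" and hh: "bform B h h > 0"
    and x: "x \<in> causal_cone B h" and y: "y \<in> causal_cone B h"
    and vx: "bform B v x > 0" and vy: "bform B v y < 0"
  shows "bform B x x * bform B y y < (bform B x y)^2"
proof (rule ccontr)
  assume "\<not> ?thesis"
  hence le: "(bform B x y)^2 \<le> bform B x x * bform B y y" by simp
  define s where "s = bform B x h"
  define t where "t = bform B y h"
  define u where "u = t *\<^sub>R x + (- s) *\<^sub>R y"
  have qx: "bform B x x \<ge> 0" and qy: "bform B y y \<ge> 0" and s: "s \<ge> 0" and t: "t \<ge> 0"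
    using x y unfolding causal_cone_def s_def t_def by auto
  text \<open>By Cauchy--Schwarz for the (then positive semidefinite) plane, q(u) \<ge> 0.\<close>
  have "bform B u u \<ge> 0"
  proof (cases "bform B x x = 0")
    case True
    thus ?thesis using le qy unfolding u_def lorentzian_quadratic_comb[OF B] by simp
  next
    case False
    hence pos: "bform B x x > 0" using qx by simp
    have "bform B x x * bform B u u
        = (t * bform B x x - s * bform B x y)^2 + s^2 * (bform B x x * bform B y y - (bform B x y)^2)"
      unfolding u_def lorentzian_quadratic_comb[OF B] by (simp add: power2_eq_square algebra_simps)
    also have "\<dots> \<ge> 0" using le by simp
    finally show ?thesis using pos by (simp add: zero_le_mult_iff)
  qed
  moreover have "bform B u h = 0" unfolding u_def s_def t_def by (simp add: bform_linear)
  ultimately have "u = 0" using lorentzian_orthogonal_timelike[OF B hh] by (meson order_antisym)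
  hence "bform B v u = 0" by (simp add: bform_zero_right)
  hence "t * bform B v x - s * bform B v y = 0" unfolding u_def by (simp add: bform_linear)
  moreover have "t * bform B v x \<ge> 0" "- s * bform B v y \<ge> 0"
    using s t vx vy by (simp_all add: mult_nonneg_nonpos)
  ultimately have "s * bform B v y = 0" by linarith
  hence "x = 0" using causal_cone_orthogonal_zero[OF B hh x] vy s_def by simp
  thus False using vx by (simp add: bform_zero_right)
qed

text \<open>In that situation the pairing (x,y) is even strictly positive.\<close>
lemma separated_pairing_pos:
  fixes B :: "real^'n^'n"
  assumes B: "signature_1_nm1 B" and hh: "bform B h h > 0"
    and x: "x \<in> causal_cone B h" and y: "y \<in> causal_cone B h"
    and vx: "bform B v x > 0" and vy: "bform B v y < 0"
  shows "bform B x y > 0"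
proof -
  have "0 \<le> bform B x x * bform B y y"
    using x y unfolding causal_cone_def by simp
  hence "bform B x y \<noteq> 0" using separated_gram_det_neg[OF assms] by auto
  thus ?thesis using causal_cone_pairing_nonneg[OF B hh x y] by simp
qed

section \<open>Integrality\<close>

text \<open>A rational vector has a common denominator.\<close>
lemma rational_common_denominator:
  assumes "x \<in> rational_pts"
  shows "\<exists>d::nat. d > 0 \<and> (\<forall>i. real d * x$i \<in> \<int>)"
proof -
  have "\<exists>k::nat. k > 0 \<and> real k * x$i \<in> \<int>" for i
  proof -
    have "x$i \<in> \<rat>" using assms unfolding rational_pts_def by auto
    then obtain a b :: int where ab: "b > 0" "x$i = of_int a / of_int b" by (rule Rats_cases') auto
    hence "real (nat b) * x$i = of_int a" by simp
    thus ?thesis using ab by (intro exI[of _ "nat b"]) auto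
  qed
  then obtain f where f: "\<And>i. f i > (0::nat) \<and> real (f i) * x$i \<in> \<int>" by metis
  define d where "d = (\<Prod>j\<in>UNIV. f j)"
  have "real d * x$i \<in> \<int>" for i
  proof -
    have "d = f i * (\<Prod>j\<in>UNIV - {i}. f j)" unfolding d_def by (simp add: prod.remove)
    hence "real d * x$i = real (\<Prod>j\<in>UNIV - {i}. f j) * (real (f i) * x$i)" by simp
    thus ?thesis using Ints_mult[OF Ints_of_nat] f[of i] by metis
  qed
  moreover have "d > 0" unfolding d_def using f by (simp add: prod_pos)
  ultimately show ?thesis by blast
qed

text \<open>An integral Gram matrix pairs lattice vectors integrally.\<close>
lemma lattice_pairing_Ints:
  assumes "integral_symmetric_form B" "v \<in> lattice_pts" "w \<in> lattice_pts"
  shows "bform B v w \<in> \<int>"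
  using assms
  unfolding bform_def inner_vec_def matrix_vector_mult_def integral_symmetric_form_def lattice_pts_def
  by (auto intro!: Ints_sum Ints_mult)

text \<open>Pairings of lattice vectors with a fixed rational vector have bounded denominators.\<close>
lemma rational_pairing_denominator:
  assumes "integral_symmetric_form B" "x \<in> rational_pts"
  obtains d :: real where "d > 0" and "\<And>v. v \<in> lattice_pts \<Longrightarrow> d * bform B v x \<in> \<int>"
proof -
  obtain d :: nat where d: "d > 0" "\<And>i. real d * x$i \<in> \<int>"
    using rational_common_denominator[OF assms(2)] by blast
  have dx: "real d *\<^sub>R x \<in> lattice_pts" using d unfolding lattice_pts_def by simp
  have "real d * bform B v x \<in> \<int>" if "v \<in> lattice_pts" for v
    using lattice_pairing_Ints[OF assms(1) that dx] by (simp add: bform_scaleR_right)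
  thus thesis using d(1) that[of "real d"] by simp
qed

section \<open>Finiteness for one pair of generators\<close>

text \<open>Estimate in the hyperbolic plane spanned by x and y.  Split v = p + w with p in the
  plane and w orthogonal to it; w is orthogonal to the timelike x + y, so q(w) \<le> 0, and
  q(p) is computed from the Gram matrix of (x, y).  Writing a = (v,x), c = (v,y) and
  \<Delta> = q(x) q(y) - (x,y)^2 < 0, this yields q(v) \<Delta> \<ge> -2 (x,y) a c.\<close>
lemma hyperbolic_plane_estimate:
  fixes B :: "real^'n^'n"
  assumes B: "signature_1_nm1 B"
    and qx: "bform B x x \<ge> 0" and qy: "bform B y y \<ge> 0" and be: "bform B x y > 0"
    and det: "bform B x x * bform B y y - (bform B x y)^2 < 0"
  shows "- 2 * bform B x y * bform B v x * bform B v y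
           \<le> bform B v v * (bform B x x * bform B y y - (bform B x y)^2)"
proof -
  define \<Delta> where "\<Delta> = bform B x x * bform B y y - (bform B x y)^2"
  define a where "a = bform B v x"
  define c where "c = bform B v y"
  define \<alpha> where "\<alpha> = (bform B y y * a - bform B x y * c) / \<Delta>"
  define \<gamma> where "\<gamma> = (bform B x x * c - bform B x y * a) / \<Delta>"
  define p where "p = \<alpha> *\<^sub>R x + \<gamma> *\<^sub>R y"
  have \<Delta>: "\<Delta> \<noteq> 0" using det unfolding \<Delta>_def by simp
  have sym: "bform B y x = bform B x y" by (rule lorentzian_sym[OF B])
  text \<open>p is the orthogonal projection of v to the plane: it has the same pairings.\<close>
  have px: "bform B p x = a"
  proof -
    have "bform B p x = \<alpha> * bform B x x + \<gamma> * bform B x y"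
      unfolding p_def by (simp add: bform_linear sym)
    also have "\<dots> = ((bform B y y * a - bform B x y * c) * bform B x x
                       + (bform B x x * c - bform B x y * a) * bform B x y) / \<Delta>"
      unfolding \<alpha>_def \<gamma>_def by (simp add: add_divide_distrib)
    also have "\<dots> = a * \<Delta> / \<Delta>"
      by (rule arg_cong[where f="\<lambda>t. t / \<Delta>"]) (simp add: \<Delta>_def power2_eq_square algebra_simps)
    finally show ?thesis using \<Delta> by simp
  qed
  have py: "bform B p y = c"
  proof -
    have "bform B p y = \<alpha> * bform B x y + \<gamma> * bform B y y"
      unfolding p_def by (simp add: bform_linear)
    also have "\<dots> = ((bform B y y * a - bform B x y * c) * bform B x y
                       + (bform B x x * c - bform B x y * a) * bform B y y) / \<Delta>"
      unfolding \<alpha>_def \<gamma>_def by (simp add: add_divide_distrib)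
    also have "\<dots> = c * \<Delta> / \<Delta>"
      by (rule arg_cong[where f="\<lambda>t. t / \<Delta>"]) (simp add: \<Delta>_def power2_eq_square algebra_simps)
    finally show ?thesis using \<Delta> by simp
  qed
  define w where "w = v - p"
  have wx: "bform B w x = 0" and wy: "bform B w y = 0"
    unfolding w_def using px py a_def c_def by (simp_all add: bform_diff_left)
  have "bform B (x + y) (x + y) > 0"
    unfolding lorentzian_quadratic_add[OF B] using qx qy be by simp
  moreover have "bform B w (x + y) = 0" using wx wy by (simp add: bform_add_right)
  ultimately have qw: "bform B w w \<le> 0" by (rule lorentzian_orthogonal_timelike(1)[OF B])
  have "bform B p w = 0"
    using wx wy lorentzian_sym[OF B, of x w] lorentzian_sym[OF B, of y w]
    unfolding p_def by (simp add: bform_linear)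
  hence "bform B v v = bform B p p + bform B w w"
    using lorentzian_quadratic_add[OF B, of p w] unfolding w_def by simp
  also have "bform B p p = \<alpha> * a + \<gamma> * c"
    using px py unfolding p_def by (simp add: bform_linear)
  also have "\<dots> = (bform B y y * a^2 - 2 * bform B x y * a * c + bform B x x * c^2) / \<Delta>"
    unfolding \<alpha>_def \<gamma>_def add_divide_distrib[symmetric] times_divide_eq_left
    by (rule arg_cong[where f="\<lambda>t. t / \<Delta>"]) (simp add: power2_eq_square algebra_simps)
  finally have "bform B v v \<le> (bform B y y * a^2 - 2 * bform B x y * a * c + bform B x x * c^2) / \<Delta>"
    using qw by simp
  hence "bform B y y * a^2 - 2 * bform B x y * a * c + bform B x x * c^2 \<le> bform B v v * \<Delta>"
    using det unfolding \<Delta>_def by (simp add: le_divide_eq)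
  moreover have "bform B y y * a^2 + bform B x x * c^2 \<ge> 0" using qx qy by simp
  ultimately show ?thesis unfolding \<Delta>_def a_def c_def by linarith
qed

text \<open>The two kinds of lattice vectors of norm > -N attached to a pair of generators:
  those separating x from y, and those orthogonal to both.\<close>
definition separating_vectors :: "real^'n^'n \<Rightarrow> real \<Rightarrow> real^'n \<Rightarrow> real^'n \<Rightarrow> (real^'n) set" where
  "separating_vectors B N x y =
     {v \<in> lattice_pts. bform B v v > - N \<and> bform B v x > 0 \<and> bform B v y < 0}"

definition orthogonal_vectors :: "real^'n^'n \<Rightarrow> real \<Rightarrow> real^'n \<Rightarrow> real^'n \<Rightarrow> (real^'n) set" where
  "orthogonal_vectors B N x y =
     {v \<in> lattice_pts. bform B v v > - N \<and> bform B v x = 0 \<and> bform B v y = 0}"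

text \<open>Two values of bounded denominators and opposite signs whose product is small are
  themselves small.\<close>
lemma discrete_opposite_values_bound:
  fixes a c d e M :: real
  assumes a: "a > 0" and c: "c < 0" and d: "d > 0" and e: "e > 0"
    and da: "d * a \<in> \<int>" and ec: "e * c \<in> \<int>" and ac: "a * (- c) < M"
  shows "\<bar>a + c\<bar> \<le> M * d + M * e"
proof -
  have "1 \<le> \<bar>d * a\<bar>" using da a d by (intro Ints_nonzero_abs_ge1) auto
  hence a1: "1 \<le> d * a" using d a by simp
  have "1 \<le> \<bar>e * c\<bar>" using ec c e by (intro Ints_nonzero_abs_ge1) auto
  hence c1: "1 \<le> e * (- c)" using e c by (simp add: abs_mult)
  have "a \<le> a * (e * (- c))" using mult_left_mono[OF c1, of a] a by simp
  also have "\<dots> = (a * (- c)) * e" by simp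
  also have "\<dots> < M * e" using ac e by (rule mult_strict_right_mono)
  finally have aM: "a < M * e" .
  have "- c \<le> (- c) * (d * a)" using mult_left_mono[OF a1, of "- c"] c by simp
  also have "\<dots> = (a * (- c)) * d" by simp
  also have "\<dots> < M * d" using ac d by (rule mult_strict_right_mono)
  finally have "- c < M * d" .
  thus ?thesis using aM a c by auto
qed

text \<open>Lattice vectors separating two rational causal generators x and y: the estimate above
  together with the discreteness of (v,x) and (v,y) bounds |(v, x + y)|.\<close>
lemma separated_finite:
  fixes B :: "real^'n^'n"
  assumes B: "signature_1_nm1 B" and BI: "integral_symmetric_form B" and hh: "bform B h h > 0"
    and x: "x \<in> causal_cone B h" "x \<in> rational_pts"
    and y: "y \<in> causal_cone B h" "y \<in> rational_pts"
  shows "finite (separating_vectors B N x y)" (is "finite ?S")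
proof (cases "?S = {}")
  case True
  thus ?thesis by (simp only: finite.emptyI)
next
  case False
  define \<Delta> where "\<Delta> = bform B x x * bform B y y - (bform B x y)^2"
  have qx: "bform B x x \<ge> 0" and qy: "bform B y y \<ge> 0"
    using x y unfolding causal_cone_def by auto
  obtain v0 where "bform B v0 x > 0" "bform B v0 y < 0"
    using False unfolding separating_vectors_def by blast
  hence \<Delta>: "\<Delta> < 0" and be: "bform B x y > 0"
    using separated_gram_det_neg[OF B hh x(1) y(1)] separated_pairing_pos[OF B hh x(1) y(1)]
    unfolding \<Delta>_def by auto
  obtain dx where dx: "dx > 0" "\<And>v. v \<in> lattice_pts \<Longrightarrow> dx * bform B v x \<in> \<int>"
    using rational_pairing_denominator[OF BI x(2)] by blast
  obtain dy where dy: "dy > 0" "\<And>v. v \<in> lattice_pts \<Longrightarrow> dy * bform B v y \<in> \<int>"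
    using rational_pairing_denominator[OF BI y(2)] by blast
  define M where "M = N * (- \<Delta>) / (2 * bform B x y)"
  have "?S \<subseteq> {v \<in> lattice_pts. bform B v v > - N \<and> \<bar>bform B v (x + y)\<bar> \<le> M * dx + M * dy}"
  proof
    fix v assume "v \<in> ?S"
    hence v: "v \<in> lattice_pts" "bform B v v > - N" "bform B v x > 0" "bform B v y < 0"
      unfolding separating_vectors_def by auto
    have "- 2 * bform B x y * bform B v x * bform B v y \<le> bform B v v * \<Delta>"
      using hyperbolic_plane_estimate[OF B qx qy be, of v] \<Delta> unfolding \<Delta>_def by simp
    also have "\<dots> < - N * \<Delta>" using v \<Delta> by (intro mult_strict_right_mono_neg) auto
    finally have "bform B v x * (- bform B v y) < M" unfolding M_def using be by (simp add: field_simps)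
    hence "\<bar>bform B v x + bform B v y\<bar> \<le> M * dx + M * dy"
      using discrete_opposite_values_bound v(3,4) dx dy v(1) by blast
    thus "v \<in> {v \<in> lattice_pts. bform B v v > - N \<and> \<bar>bform B v (x + y)\<bar> \<le> M * dx + M * dy}"
      using v by (simp add: bform_add_right)
  qed
  moreover have "bform B (x + y) (x + y) > 0"
    unfolding lorentzian_quadratic_add[OF B] using qx qy be by simp
  ultimately show ?thesis using lorentzian_finite_slab[OF B] finite_subset by blast
qed

text \<open>Lattice vectors orthogonal to two generators with (x,y) > 0 lie in the orthogonal
  complement of the timelike vector x + y.\<close>
lemma orthogonal_pair_finite:
  fixes B :: "real^'n^'n"
  assumes B: "signature_1_nm1 B"
    and qx: "bform B x x \<ge> 0" and qy: "bform B y y \<ge> 0" and be: "bform B x y > 0"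
  shows "finite (orthogonal_vectors B N x y)"
proof -
  have "bform B (x + y) (x + y) > 0"
    unfolding lorentzian_quadratic_add[OF B] using qx qy be by simp
  hence "finite {v \<in> lattice_pts. bform B v v > - N \<and> \<bar>bform B v (x + y)\<bar> \<le> 0}"
    by (rule lorentzian_finite_slab[OF B])
  thus ?thesis by (rule finite_subset[rotated]) (auto simp: orthogonal_vectors_def bform_add_right)
qed

section \<open>Vectors orthogonal to a point of the cone\<close>

text \<open>A vanishing nonnegative combination \<Sum> c_u a_u = 0 either has terms of both signs on the
  support of c, or vanishes termwise there.\<close>
lemma nonneg_combination_zero_sign:
  fixes c a :: "'a \<Rightarrow> real"
  assumes X: "finite X" and c: "\<And>u. u \<in> X \<Longrightarrow> c u \<ge> 0" and sum: "(\<Sum>u\<in>X. c u * a u) = 0"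
  shows "(\<exists>x\<in>X. c x > 0 \<and> a x > 0) \<and> (\<exists>y\<in>X. c y > 0 \<and> a y < 0) \<or> (\<forall>u\<in>X. c u > 0 \<longrightarrow> a u = 0)"
proof -
  text \<open>If no term of the support is positive, all terms vanish there.\<close>
  have vanish: "\<forall>u\<in>X. c u > 0 \<longrightarrow> b u = 0"
    if b: "(\<Sum>u\<in>X. c u * b u) = 0" "\<not> (\<exists>x\<in>X. c x > 0 \<and> b x > 0)" for b
  proof (intro ballI impI)
    fix u assume u: "u \<in> X" "c u > 0"
    have nonneg: "0 \<le> c u' * - b u'" if "u' \<in> X" for u'
    proof (cases "c u' > 0")
      case True
      hence "b u' \<le> 0" using b(2) that by auto
      thus ?thesis using True by (simp add: mult_nonneg_nonpos)
    qed (use c[OF that] in simp)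
    have "(\<Sum>u\<in>X. c u * - b u) = 0" using b(1) by (simp add: sum_negf)
    with sum_nonneg_0[where f = "\<lambda>u. c u * - b u"] X nonneg u(1) have "c u * - b u = 0"
      by blast
    thus "b u = 0" using u(2) by simp
  qed
  show ?thesis
  proof (cases "\<exists>x\<in>X. c x > 0 \<and> a x > 0")
    case False
    thus ?thesis using vanish[OF sum] by (intro disjI2)
  next
    case pos: True
    have sum_neg: "(\<Sum>u\<in>X. c u * - a u) = 0" using sum by (simp add: sum_negf)
    show ?thesis
    proof (cases "\<exists>y\<in>X. c y > 0 \<and> - a y > 0")
      case True
      thus ?thesis using pos by (intro disjI1) auto
    next
      case False
      thus ?thesis using vanish[OF sum_neg] by (intro disjI2) simp
    qed
  qed
qed

text \<open>A positive double sum \<Sum>\<Sum> c_u c_u' g(u,u') with c \<ge> 0 has a positive term.\<close>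
lemma double_sum_pos:
  fixes c :: "'a \<Rightarrow> real"
  assumes c: "\<And>u. u \<in> X \<Longrightarrow> c u \<ge> 0"
    and pos: "(\<Sum>u\<in>X. c u * (\<Sum>u'\<in>X. c u' * g u u')) > 0"
  shows "\<exists>u\<in>X. \<exists>u'\<in>X. c u > 0 \<and> c u' > 0 \<and> g u u' > 0"
proof (rule ccontr)
  assume none: "\<not> ?thesis"
  have nonpos_term: "c u * (c u' * g u u') \<le> 0" if u: "u \<in> X" "u' \<in> X" for u u'
  proof (cases "c u > 0 \<and> c u' > 0")
    case True
    hence "g u u' \<le> 0" using none u by (meson not_le)
    thus ?thesis using True by (simp add: mult_le_0_iff)
  next
    case False
    hence "c u = 0 \<or> c u' = 0" using c[OF u(1)] c[OF u(2)] by linarith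
    thus ?thesis by auto
  qed
  have "(\<Sum>u\<in>X. c u * (\<Sum>u'\<in>X. c u' * g u u')) = (\<Sum>u\<in>X. \<Sum>u'\<in>X. c u * (c u' * g u u'))"
    by (simp add: sum_distrib_left)
  also have "\<dots> \<le> 0" using nonpos_term by (intro sum_nonpos) blast
  finally show False using pos by simp
qed

text \<open>Every generator lies in the cone it generates.\<close>
lemma gen_cone_generator:
  assumes "finite X" "x \<in> X"
  shows "x \<in> gen_cone X"
proof -
  have "(\<Sum>u\<in>X. (if u = x then 1 else 0) *\<^sub>R u) = x"
    using assms by (simp add: if_distrib[of "\<lambda>r. r *\<^sub>R _"] cong: if_cong)
  thus ?thesis unfolding gen_cone_def by (intro CollectI exI[of _ "\<lambda>u. if u = x then 1 else 0"]) auto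
qed

text \<open>A vector orthogonal to a timelike point x0 of the cone over X either separates two
  generators, or is orthogonal to two generators x, y with (x,y) > 0.\<close>
lemma orthogonal_witness_pair:
  fixes B :: "real^'n^'n"
  assumes X: "finite X" and x0: "x0 \<in> gen_cone X"
    and qx0: "bform B x0 x0 > 0" and vx0: "bform B v x0 = 0"
  shows "\<exists>x\<in>X. \<exists>y\<in>X. (bform B v x > 0 \<and> bform B v y < 0)
           \<or> (bform B v x = 0 \<and> bform B v y = 0 \<and> bform B x y > 0)"
proof -
  obtain c where c: "\<And>u. u \<in> X \<Longrightarrow> c u \<ge> 0" and x0e: "x0 = (\<Sum>u\<in>X. c u *\<^sub>R u)"
    using x0 unfolding gen_cone_def by blast
  have sum: "(\<Sum>u\<in>X. c u * bform B v u) = 0"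
    using vx0 unfolding x0e bform_sum_right[OF X] .
  have "(\<exists>x\<in>X. c x > 0 \<and> bform B v x > 0) \<and> (\<exists>y\<in>X. c y > 0 \<and> bform B v y < 0)
         \<or> (\<forall>u\<in>X. c u > 0 \<longrightarrow> bform B v u = 0)"
    by (rule nonneg_combination_zero_sign[where c = c and a = "bform B v", OF X c sum])
  then consider (separating) x y where "x \<in> X" "y \<in> X" "bform B v x > 0" "bform B v y < 0"
    | (orthogonal) "\<forall>u\<in>X. c u > 0 \<longrightarrow> bform B v u = 0"
    by blast
  thus ?thesis
  proof cases
    case separating
    thus ?thesis by blast
  next
    case orthogonal
    have pos: "(\<Sum>u\<in>X. c u * (\<Sum>u'\<in>X. c u' * bform B u' u)) > 0"
      using qx0 unfolding x0e bform_sum_left[OF X] bform_sum_right[OF X] .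
    have "\<exists>u\<in>X. \<exists>u'\<in>X. c u > 0 \<and> c u' > 0 \<and> bform B u' u > 0"
      by (rule double_sum_pos[where c = c and g = "\<lambda>u u'. bform B u' u", OF c pos])
    then obtain x y where "y \<in> X" "x \<in> X" "c y > 0" "c x > 0" "bform B x y > 0" by blast
    thus ?thesis using orthogonal by blast
  qed
qed

text \<open>Hence the set in the theorem is covered by the vectors attached to pairs of
  generators.\<close>
lemma cone_orthogonal_cover:
  fixes B :: "real^'n^'n"
  assumes X: "finite X"
  shows "{v \<in> lattice_pts. bform B v v > - N \<and> (\<exists>x \<in> gen_cone X \<inter> pos_cone B h. bform B v x = 0)}
         \<subseteq> (\<Union>x\<in>X. \<Union>y\<in>X. separating_vectors B N x y)
             \<union> (\<Union>x\<in>X. \<Union>y\<in>{y \<in> X. bform B x y > 0}. orthogonal_vectors B N x y)"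
proof
  fix v assume v: "v \<in> {v \<in> lattice_pts. bform B v v > - N \<and>
                           (\<exists>x \<in> gen_cone X \<inter> pos_cone B h. bform B v x = 0)}"
  then obtain x0 where x0: "x0 \<in> gen_cone X" "bform B x0 x0 > 0" "bform B v x0 = 0"
    unfolding pos_cone_def by blast
  from orthogonal_witness_pair[OF X x0] obtain x y where "x \<in> X" "y \<in> X"
    "bform B v x > 0 \<and> bform B v y < 0 \<or> bform B v x = 0 \<and> bform B v y = 0 \<and> bform B x y > 0"
    by blast
  with v show "v \<in> (\<Union>x\<in>X. \<Union>y\<in>X. separating_vectors B N x y)
                   \<union> (\<Union>x\<in>X. \<Union>y\<in>{y \<in> X. bform B x y > 0}. orthogonal_vectors B N x y)"
    unfolding separating_vectors_def orthogonal_vectors_def by blast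
qed

section \<open>The main theorem\<close>

theorem proposition3p4:
  fixes B :: "real^'n^'n" and h :: "real^'n" and N :: real and X :: "(real^'n) set"
  assumes "integral_symmetric_form B"
    and "signature_1_nm1 B"
    and "h \<in> lattice_pts" and "bform B h h > 0"
    and "N > 0"
    and "finite X" and "X \<subseteq> rational_pts"
    and "gen_cone X \<subseteq> closure (pos_cone B h)"
  shows "finite {v \<in> lattice_pts. bform B v v > - N \<and>
           (\<exists>x \<in> gen_cone X \<inter> pos_cone B h. bform B v x = 0)}"
proof -
  note BI = assms(1) and B = assms(2) and hh = assms(4) and X = assms(6)
  have causal: "x \<in> causal_cone B h" and rational: "x \<in> rational_pts" if "x \<in> X" for x
    using gen_cone_generator[OF X that] assms(7,8) closure_pos_cone_subset that by blast+
  have finite_sep: "finite (separating_vectors B N x y)" if "x \<in> X" "y \<in> X" for x y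
    using separated_finite[OF B BI hh] causal rational that by blast
  have finite_orth: "finite (orthogonal_vectors B N x y)" if "x \<in> X" "y \<in> X" "bform B x y > 0" for x y
    using orthogonal_pair_finite[OF B _ _ that(3)] causal[OF that(1)] causal[OF that(2)]
    unfolding causal_cone_def by blast
  have finite_pos: "finite {y \<in> X. bform B x y > 0}" for x using X by simp
  show ?thesis
    by (rule finite_subset[OF cone_orthogonal_cover[where B = B and N = N and h = h, OF X]])
      (intro finite_UnI finite_UN_I X finite_pos finite_sep finite_orth; simp)
qed

end
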